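(* For any integer $d\ge 2$ and any finite $c$, the family $F_d$ of all generically $d$-rigid finite graphs is not $d$-rigid with $c$-locations.
   Context: An embedding of a finite graph $G=(V,E)$ into $\mathbb{R}^d$ is a map $f:V\to\mathbb{R}^d$ such that $f(V)$ affinely spans $\mathbb{R}^d$; the framework $f(G)$ realizes each edge as the corresponding segment. A motion of $f(G)$ is a map $a:V\to\mathbb{R}^d$ with $\langle a(v)-a(u),f(v)-f(u)\rangle=0$ for every edge $uv\in E$. A motion is trivial if this relation holds for every pair of vertices $u,v\in V$, and nontrivial otherwise. The framework $f(G)$ is infinitesimally rigid if all its motions are trivial. A graph is generically $d$-rigid if $f(G)$ is infinitesimally rigid for a generic map $f:V\to\mathbb{R}^d$ (one whose coordinates are algebraically independent over $\mathbb{Q}$). A family $F$ of graphs is $d$-rigid with $c$-locations if there is a set $A\subseteq\mathbb{R}^d$ with $|A|=c$ such that for every $G\in F$ there is a map $f:V(G)\to A$ with $f(G)$ infinitesimally rigid. *)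

theory Defs
  imports "HOL-Analysis.Analysis" "HOL-Library.Poly_Mapping" "Graph_Theory.Pair_Digraph"
begin

text \<open>
  Finite simple graphs are the \<^locale>\<open>pair_graph\<close>s of the graph library: finite, loop-free,
  symmetric digraphs without parallel arcs. An edge is a pair of opposite arcs; the condition that
  a motion satisfies on an arc is symmetric in its two ends.

  A map from the vertex set into space is a total function of which only the values on the
  vertices matter.
\<close>

definition embedding :: "'v pair_pre_digraph \<Rightarrow> ('v \<Rightarrow> real ^ 'd) \<Rightarrow> bool" where
  "embedding G f \<longleftrightarrow> affine hull (f ` pverts G) = UNIV"

definition motion :: "'v pair_pre_digraph \<Rightarrow> ('v \<Rightarrow> real ^ 'd) \<Rightarrow> ('v \<Rightarrow> real ^ 'd) \<Rightarrow> bool" where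
  "motion G f a \<longleftrightarrow> (\<forall>(u, v) \<in> parcs G. (a v - a u) \<bullet> (f v - f u) = 0)"

definition trivial_motion ::
  "'v pair_pre_digraph \<Rightarrow> ('v \<Rightarrow> real ^ 'd) \<Rightarrow> ('v \<Rightarrow> real ^ 'd) \<Rightarrow> bool" where
  "trivial_motion G f a \<longleftrightarrow>
     motion G f a \<and> (\<forall>u \<in> pverts G. \<forall>v \<in> pverts G. (a v - a u) \<bullet> (f v - f u) = 0)"

text \<open>
  Frameworks are formed from embeddings only, so spanning is part of infinitesimal rigidity.
  Without it a constant map would make every graph rigid.
\<close>

definition infinitesimally_rigid :: "'v pair_pre_digraph \<Rightarrow> ('v \<Rightarrow> real ^ 'd) \<Rightarrow> bool" where
  "infinitesimally_rigid G f \<longleftrightarrow>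
     embedding G f \<and> (\<forall>a. motion G f a \<longrightarrow> trivial_motion G f a)"

text \<open>
  A polynomial with rational coefficients in variables indexed by \<open>'i\<close> is a finitely supported
  map from monomials to coefficients, and a monomial is a finitely supported map from variables
  to exponents.
\<close>

definition rat_poly_eval :: "('i \<Rightarrow> real) \<Rightarrow> (('i \<Rightarrow>\<^sub>0 nat) \<Rightarrow>\<^sub>0 rat) \<Rightarrow> real" where
  "rat_poly_eval x p =
     (\<Sum>m \<in> Poly_Mapping.keys p. of_rat (Poly_Mapping.lookup p m) *
        (\<Prod>i \<in> Poly_Mapping.keys m. x i ^ Poly_Mapping.lookup m i))"

definition algebraically_independent_over_rat :: "('i \<Rightarrow> real) \<Rightarrow> 'i set \<Rightarrow> bool" where
  "algebraically_independent_over_rat x I \<longleftrightarrow>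
     (\<forall>p. (\<forall>m \<in> Poly_Mapping.keys p. Poly_Mapping.keys m \<subseteq> I) \<longrightarrow>
        rat_poly_eval x p = 0 \<longrightarrow> p = 0)"

definition generic_map :: "'v pair_pre_digraph \<Rightarrow> ('v \<Rightarrow> real ^ 'd) \<Rightarrow> bool" where
  "generic_map G f \<longleftrightarrow>
     algebraically_independent_over_rat (\<lambda>(v, i). f v $ i) (pverts G \<times> UNIV)"

text \<open>
  The dimension \<open>d\<close> is \<open>CARD('d)\<close>; the type argument passes it where no map into \<open>real ^ 'd\<close>
  occurs among the arguments.
\<close>

definition generically_rigid :: "'d::finite itself \<Rightarrow> 'v pair_pre_digraph \<Rightarrow> bool" where
  "generically_rigid _ G \<longleftrightarrow>
     (\<forall>f :: 'v \<Rightarrow> real ^ 'd. generic_map G f \<longrightarrow> infinitesimally_rigid G f)"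

definition rigid_with_locations ::
  "'d::finite itself \<Rightarrow> nat \<Rightarrow> 'v pair_pre_digraph set \<Rightarrow> bool" where
  "rigid_with_locations _ c F \<longleftrightarrow>
     (\<exists>A :: (real ^ 'd) set. finite A \<and> card A = c \<and>
        (\<forall>G \<in> F. \<exists>f. f ` pverts G \<subseteq> A \<and> infinitesimally_rigid G f))"

text \<open>
  Every finite graph has an isomorphic copy whose vertices are natural numbers, and rigidity is
  invariant under isomorphism.
\<close>

definition generically_rigid_graphs :: "'d::finite itself \<Rightarrow> nat pair_pre_digraph set" where
  "generically_rigid_graphs D = {G. pair_graph G \<and> generically_rigid D G}"

end

theory Submission
  imports Defs
begin

text \<open>
  Given the \<open>c\<close> locations, take a complete graph on more than \<open>c + d\<close> vertices and attach to every
  \<open>d\<close>-subset \<open>S\<close> of it a new vertex of degree \<open>d\<close> joined to \<open>S\<close>. At a generic position this is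
  rigid: a motion agrees on the complete graph with an infinitesimal isometry \<open>x \<mapsto> T x + b\<close>,
  \<open>T\<close> skew, and the \<open>d\<close> independent edge directions at a new vertex force agreement there too.
  If all vertices are placed at \<open>c\<close> locations, two vertices \<open>i \<noteq> j\<close> of the complete graph coincide.
  A new vertex joined to both then has at most \<open>d - 1\<close> distinct edge directions, so it can be moved
  on its own. As \<open>d \<ge> 2\<close>, some \<open>d\<close>-subset contains both \<open>i\<close> and \<open>j\<close>.
\<close>

section \<open>Evaluation of rational polynomials\<close>

text \<open>The inner product of \<open>rat_poly_eval\<close>, named so that multiplicativity can be
  proved on monomials first.\<close>

definition monomial_eval :: "('i \<Rightarrow> real) \<Rightarrow> ('i \<Rightarrow>\<^sub>0 nat) \<Rightarrow> real" where
  "monomial_eval x m = (\<Prod>i \<in> Poly_Mapping.keys m. x i ^ Poly_Mapping.lookup m i)"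

lemma monomial_eval_superset:
  assumes "finite A" "Poly_Mapping.keys m \<subseteq> A"
  shows "monomial_eval x m = (\<Prod>i \<in> A. x i ^ Poly_Mapping.lookup m i)"
  unfolding monomial_eval_def
  by (rule prod.mono_neutral_left) (use assms in \<open>auto simp: in_keys_iff\<close>)

lemma monomial_eval_add: "monomial_eval x (m + n) = monomial_eval x m * monomial_eval x n"
proof -
  let ?A = "Poly_Mapping.keys m \<union> Poly_Mapping.keys n"
  have "monomial_eval x (m + n) = (\<Prod>i \<in> ?A. x i ^ Poly_Mapping.lookup (m + n) i)"
    by (rule monomial_eval_superset) (use Poly_Mapping.keys_add[of m n] in auto)
  also have "\<dots> = (\<Prod>i \<in> ?A. x i ^ Poly_Mapping.lookup m i) * (\<Prod>i \<in> ?A. x i ^ Poly_Mapping.lookup n i)"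
    by (simp add: lookup_add power_add prod.distrib)
  also have "\<dots> = monomial_eval x m * monomial_eval x n"
    by (simp add: monomial_eval_superset[of ?A])
  finally show ?thesis .
qed

lemma rat_poly_eval_superset:
  assumes "finite A" "Poly_Mapping.keys p \<subseteq> A"
  shows "rat_poly_eval x p = (\<Sum>m \<in> A. of_rat (Poly_Mapping.lookup p m) * monomial_eval x m)"
  unfolding rat_poly_eval_def monomial_eval_def[symmetric]
  by (rule sum.mono_neutral_left) (use assms in \<open>auto simp: in_keys_iff\<close>)

lemma rat_poly_eval_zero [simp]: "rat_poly_eval x 0 = 0"
  by (simp add: rat_poly_eval_def)

lemma rat_poly_eval_single:
  "rat_poly_eval x (Poly_Mapping.single m c) = of_rat c * monomial_eval x m"
  by (subst rat_poly_eval_superset[of "{m}"]) auto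

lemma rat_poly_eval_add: "rat_poly_eval x (p + q) = rat_poly_eval x p + rat_poly_eval x q"
proof -
  let ?A = "Poly_Mapping.keys p \<union> Poly_Mapping.keys q"
  have "rat_poly_eval x (p + q)
      = (\<Sum>m \<in> ?A. of_rat (Poly_Mapping.lookup (p + q) m) * monomial_eval x m)"
    by (rule rat_poly_eval_superset) (use Poly_Mapping.keys_add[of p q] in auto)
  also have "\<dots> = rat_poly_eval x p + rat_poly_eval x q"
    by (simp add: rat_poly_eval_superset[of ?A] lookup_add of_rat_add distrib_right sum.distrib)
  finally show ?thesis .
qed

lemma rat_poly_eval_sum: "rat_poly_eval x (\<Sum>a\<in>A. p a) = (\<Sum>a\<in>A. rat_poly_eval x (p a))"
  by (induction A rule: infinite_finite_induct) (simp_all add: rat_poly_eval_add)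

lemma poly_mapping_sum_single:
  fixes p :: "'a \<Rightarrow>\<^sub>0 'b::comm_monoid_add"
  shows "(\<Sum>m \<in> Poly_Mapping.keys p. Poly_Mapping.single m (Poly_Mapping.lookup p m)) = p"
  by (rule poly_mapping_eqI)
    (auto simp: lookup_sum lookup_single when_def sum.delta in_keys_iff)

text \<open>Both factors are split into single terms, whose products add exponents, so
  \<open>monomial_eval_add\<close> suffices.\<close>

lemma rat_poly_eval_mult: "rat_poly_eval x (p * q) = rat_poly_eval x p * rat_poly_eval x q"
proof -
  let ?s = "\<lambda>r m. Poly_Mapping.single m (Poly_Mapping.lookup r m)"
  have "p * q = (\<Sum>m \<in> Poly_Mapping.keys p. ?s p m) * (\<Sum>n \<in> Poly_Mapping.keys q. ?s q n)"
    by (simp add: poly_mapping_sum_single)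
  also have "\<dots> = (\<Sum>m \<in> Poly_Mapping.keys p. \<Sum>n \<in> Poly_Mapping.keys q.
      Poly_Mapping.single (m + n) (Poly_Mapping.lookup p m * Poly_Mapping.lookup q n))"
    by (simp add: sum_product mult_single)
  finally show ?thesis
    by (simp add: rat_poly_eval_sum rat_poly_eval_single monomial_eval_add of_rat_mult)
       (simp add: rat_poly_eval_def monomial_eval_def sum_product algebra_simps)
qed

text \<open>Closure under ring operations lets a determinant be recognised as a rational polynomial
  without computing its coefficients.\<close>

definition rat_poly_fun :: "'i set \<Rightarrow> (('i \<Rightarrow> real) \<Rightarrow> real) \<Rightarrow> bool" where
  "rat_poly_fun I F \<longleftrightarrow>
     (\<exists>p. (\<forall>m \<in> Poly_Mapping.keys p. Poly_Mapping.keys m \<subseteq> I) \<and> F = (\<lambda>x. rat_poly_eval x p))"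

lemma rat_poly_fun_const: "rat_poly_fun I (\<lambda>x. of_rat c)"
  unfolding rat_poly_fun_def
  by (rule exI[of _ "Poly_Mapping.single 0 c"])
    (auto simp: rat_poly_eval_single monomial_eval_def split: if_splits)

lemma rat_poly_fun_of_int: "rat_poly_fun I (\<lambda>x. of_int k)"
  using rat_poly_fun_const[of I "of_int k"] by simp

lemma rat_poly_fun_var: "i \<in> I \<Longrightarrow> rat_poly_fun I (\<lambda>x. x i)"
  unfolding rat_poly_fun_def
  by (rule exI[of _ "Poly_Mapping.single (Poly_Mapping.single i 1) 1"])
    (auto simp: rat_poly_eval_single monomial_eval_def split: if_splits)

lemma rat_poly_fun_add:
  assumes "rat_poly_fun I F" "rat_poly_fun I H"
  shows "rat_poly_fun I (\<lambda>x. F x + H x)"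
proof -
  obtain p q where
    "\<forall>m \<in> Poly_Mapping.keys p. Poly_Mapping.keys m \<subseteq> I" "F = (\<lambda>x. rat_poly_eval x p)"
    "\<forall>m \<in> Poly_Mapping.keys q. Poly_Mapping.keys m \<subseteq> I" "H = (\<lambda>x. rat_poly_eval x q)"
    using assms unfolding rat_poly_fun_def by blast
  then show ?thesis
    unfolding rat_poly_fun_def using Poly_Mapping.keys_add[of p q]
    by (intro exI[of _ "p + q"]) (auto simp: rat_poly_eval_add)
qed

lemma rat_poly_fun_mult:
  assumes "rat_poly_fun I F" "rat_poly_fun I H"
  shows "rat_poly_fun I (\<lambda>x. F x * H x)"
proof -
  obtain p q where pq:
    "\<forall>m \<in> Poly_Mapping.keys p. Poly_Mapping.keys m \<subseteq> I" "F = (\<lambda>x. rat_poly_eval x p)"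
    "\<forall>m \<in> Poly_Mapping.keys q. Poly_Mapping.keys m \<subseteq> I" "H = (\<lambda>x. rat_poly_eval x q)"
    using assms unfolding rat_poly_fun_def by blast
  have "Poly_Mapping.keys m \<subseteq> I" if "m \<in> Poly_Mapping.keys (p * q)" for m
  proof -
    obtain a b where "m = a + b" "a \<in> Poly_Mapping.keys p" "b \<in> Poly_Mapping.keys q"
      using \<open>m \<in> Poly_Mapping.keys (p * q)\<close> Poly_Mapping.keys_mult[of p q] by blast
    then show ?thesis
      using Poly_Mapping.keys_add[of a b] pq by blast
  qed
  then show ?thesis
    unfolding rat_poly_fun_def using pq
    by (intro exI[of _ "p * q"]) (auto simp: rat_poly_eval_mult)
qed

lemma rat_poly_fun_diff:
  assumes "rat_poly_fun I F" "rat_poly_fun I H"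
  shows "rat_poly_fun I (\<lambda>x. F x - H x)"
  using rat_poly_fun_add[OF assms(1) rat_poly_fun_mult[OF rat_poly_fun_of_int[of I "-1"] assms(2)]]
  by simp

lemma rat_poly_fun_sum:
  assumes "\<And>a. a \<in> A \<Longrightarrow> rat_poly_fun I (F a)"
  shows "rat_poly_fun I (\<lambda>x. \<Sum>a\<in>A. F a x)"
  using assms rat_poly_fun_of_int[of I 0]
  by (induction A rule: infinite_finite_induct) (auto intro: rat_poly_fun_add)

lemma rat_poly_fun_prod:
  assumes "\<And>a. a \<in> A \<Longrightarrow> rat_poly_fun I (F a)"
  shows "rat_poly_fun I (\<lambda>x. \<Prod>a\<in>A. F a x)"
  using assms rat_poly_fun_of_int[of I 1]
  by (induction A rule: infinite_finite_induct) (auto intro: rat_poly_fun_mult)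

lemma rat_poly_fun_det:
  fixes M :: "('i \<Rightarrow> real) \<Rightarrow> real ^ 'n ^ 'n"
  assumes "\<And>i j. rat_poly_fun I (\<lambda>x. M x $ i $ j)"
  shows "rat_poly_fun I (\<lambda>x. det (M x))"
  unfolding det_def
  by (intro rat_poly_fun_sum rat_poly_fun_mult rat_poly_fun_of_int rat_poly_fun_prod assms)

text \<open>Independence forces the representing polynomial itself to be zero. Contrapositively, a
  single \<open>y\<close> with \<open>F y\<close> nonzero gives nonvanishing at every generic
  point.\<close>

lemma rat_poly_fun_vanishing:
  assumes "algebraically_independent_over_rat x I" "rat_poly_fun I F" "F x = 0"
  shows "F y = 0"
  using assms unfolding algebraically_independent_over_rat_def rat_poly_fun_def
  by (metis rat_poly_eval_zero)

section \<open>Spanning directions\<close>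

text \<open>The matrix with rows \<open>f (e i) - f w\<close> has a determinant polynomial in the
  coordinates. It is nonzero at one special placement, hence at \<open>f\<close>, so its kernel is
  trivial.\<close>

lemma generic_map_general_position:
  fixes f :: "'v \<Rightarrow> real ^ 'd" and e :: "'d \<Rightarrow> 'v"
  assumes gen: "generic_map G f" and e: "inj e" "range e \<subseteq> pverts G"
    and w: "w \<in> pverts G" "w \<notin> range e"
    and z: "\<And>i. z \<bullet> (f (e i) - f w) = 0"
  shows "z = 0"
proof -
  define M where "M = (\<lambda>x. (\<chi> i j. x (e i, j) - x (w, j)) :: real ^ 'd ^ 'd)"
  let ?x = "\<lambda>(v, i). f v $ i"
  have "rat_poly_fun (pverts G \<times> UNIV) (\<lambda>x. det (M x))"
    by (rule rat_poly_fun_det)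
      (use e w in \<open>auto simp: M_def intro!: rat_poly_fun_diff rat_poly_fun_var\<close>)
  then have vanish: "det (M ?x) = 0 \<Longrightarrow> det (M y) = 0" for y
    using rat_poly_fun_vanishing gen unfolding generic_map_def by blast
  \<comment> \<open>The special placement puts \<open>e i\<close> at the i-th standard basis vector
    and all other vertices, \<open>w\<close> included, at the origin.\<close>
  have "M (\<lambda>(v, j). if v = e j then 1 else 0) = mat 1"
    using e w by (auto simp: M_def mat_def vec_eq_iff inj_eq)
  then have "det (M ?x) \<noteq> 0"
    using vanish by (metis det_I zero_neq_one)
  then obtain B where "B ** M ?x = mat 1"
    by (metis invertible_det_nz invertible_def)
  moreover have "M ?x *v z = 0"
    using z by (simp add: M_def vec_eq_iff matrix_vector_mult_def inner_vec_def mult.commute)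
  ultimately show ?thesis
    using matrix_left_invertible_ker by blast
qed

lemma ex_inj_enum:
  assumes "finite S" "card S = CARD('d::finite)"
  obtains e :: "'d::finite \<Rightarrow> 'v" where "inj e" "range e = S"
  using finite_same_card_bij[of "UNIV :: 'd set" S] assms
  unfolding bij_betw_def by auto

lemma span_eq_UNIV_if_orthogonal:
  fixes S :: "'a::euclidean_space set"
  assumes "\<And>z. (\<And>x. x \<in> S \<Longrightarrow> z \<bullet> x = 0) \<Longrightarrow> z = 0"
  shows "span S = UNIV"
proof (rule ccontr)
  assume "span S \<noteq> UNIV"
  then obtain a where "a \<noteq> 0" "span S \<subseteq> {x. a \<bullet> x = 0}"
    using span_not_univ_subset_hyperplane by blast
  then show False
    using assms[of a] span_base by blast
qed

lemma affine_hull_eq_UNIV_if_orthogonal: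
  fixes S :: "'a::euclidean_space set"
  assumes "w \<in> S" and "\<And>z. (\<And>x. x \<in> S \<Longrightarrow> z \<bullet> (x - w) = 0) \<Longrightarrow> z = 0"
  shows "affine hull S = UNIV"
proof -
  have "span ((\<lambda>x. - w + x) ` S) = UNIV"
    by (rule span_eq_UNIV_if_orthogonal) (use assms(2) in auto)
  then show ?thesis
    using affine_hull_span_gen[of w S] assms(1) by (simp add: hull_inc surj_plus)
qed

text \<open>The hyperplane through \<open>w\<close> with normal \<open>z\<close> contains
  \<open>S\<close>, hence its affine hull, hence the point \<open>w + z\<close>.\<close>

lemma orthogonal_affine_hull_UNIV:
  fixes S :: "'a::euclidean_space set"
  assumes "affine hull S = UNIV" and "\<And>x. x \<in> S \<Longrightarrow> z \<bullet> (x - w) = 0"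
  shows "z = 0"
proof -
  have "affine hull S \<subseteq> {x. z \<bullet> x = z \<bullet> w}"
    by (rule hull_minimal) (use assms(2) in \<open>auto simp: affine_hyperplane inner_diff_right\<close>)
  then have "z \<bullet> (w + z) = z \<bullet> w"
    using assms(1) by auto
  then show ?thesis
    by (simp add: inner_add_right)
qed

text \<open>The vectors \<open>x i\<close> form a basis, so \<open>b\<close> prescribes a linear
  map; \<open>skew\<close> says that this map is skew-adjoint on the basis, hence everywhere. It is
  the linear part of an infinitesimal isometry.\<close>

lemma ex_skew_linear_extension:
  fixes x b :: "'d::finite \<Rightarrow> real ^ 'd"
  assumes x: "\<And>z. (\<And>i. z \<bullet> x i = 0) \<Longrightarrow> z = 0"
    and skew: "\<And>i j. b i \<bullet> x j + b j \<bullet> x i = 0"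
  obtains T where "linear T" "\<And>i. T (x i) = b i" "\<And>y. T y \<bullet> y = 0"
proof -
  define M where "M = (\<chi> i. x i)"
  have "\<exists>B. B ** M = mat 1"
    unfolding matrix_left_invertible_ker
    using x by (auto simp: M_def vec_eq_iff matrix_vector_mul_component inner_commute)
  then obtain B where B: "M ** B = mat 1"
    using matrix_left_right_inverse by blast
  \<comment> \<open>From \<open>M ** B = mat 1\<close>, multiplying the row \<open>x i\<close> by
    \<open>B\<close> gives the i-th unit row, which the matrix with rows \<open>b j\<close> turns
    into \<open>b i\<close>. \<open>C\<close> is the transpose of this composition, acting on
    columns.\<close>
  define C where "C = transpose ((\<chi> j. b j) :: real ^ 'd ^ 'd) ** transpose B"
  define T where "T = (*v) C"
  have lin: "linear T"
    by (simp add: T_def)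
  have Tx: "T (x i) = b i" for i
  proof -
    have row: "axis i 1 v* ((\<chi> i. g i) :: real ^ 'd ^ 'd) = g i" for g
      by (simp add: vec_eq_iff vector_matrix_mult_def axis_def if_distrib if_distribR cong: if_cong)
    have "x i v* B = axis i 1 v* (M ** B)"
      by (simp add: M_def row flip: vector_matrix_mul_assoc)
    then show ?thesis
      by (simp add: B T_def C_def row flip: matrix_vector_mul_assoc)
  qed
  have "T (x i) + adjoint T (x i) = 0" for i
  proof (rule x)
    fix j
    have "adjoint T (x i) \<bullet> x j = T (x j) \<bullet> x i"
      using adjoint_works[OF lin, of "x j" "x i"] by (simp add: inner_commute)
    then show "(T (x i) + adjoint T (x i)) \<bullet> x j = 0"
      using skew[of i j] by (simp add: inner_add_left Tx)
  qed
  \<comment> \<open>\<open>T + adjoint T\<close> is self-adjoint, so vanishing on a basis makes all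
    its values orthogonal to that basis.\<close>
  then have sym: "T y + adjoint T y = 0" for y
  proof (intro x)
    fix i
    have "(T y + adjoint T y) \<bullet> x i = y \<bullet> (adjoint T (x i) + T (x i))"
      using adjoint_works[OF lin, of y "x i"] adjoint_works[OF lin, of "x i" y]
      by (simp add: inner_add_left inner_add_right inner_commute)
    then show "(T y + adjoint T y) \<bullet> x i = 0"
      using \<open>T (x i) + adjoint T (x i) = 0\<close> by (simp add: add.commute)
  qed
  have "T y \<bullet> y = 0" for y
  proof -
    have "2 * (T y \<bullet> y) = y \<bullet> (T y + adjoint T y)"
      using adjoint_works[OF lin, of y y] by (simp add: inner_add_right inner_commute)
    then show ?thesis
      by (simp add: sym)
  qed
  then show ?thesis
    using that lin Tx by blast
qed

section \<open>Generic rigidity by cliques and attached vertices\<close>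

text \<open>A motion determines an infinitesimal isometry on one simplex in \<open>K\<close>.
  Agreement then spreads to all of \<open>K\<close> and from there along d independent edges to each
  vertex.\<close>

lemma generically_rigid_attached_clique:
  fixes G :: "'v pair_pre_digraph"
  assumes K: "finite K" "K \<subseteq> pverts G" "CARD('d::finite) < card K"
    and attached: "\<And>v. v \<in> pverts G \<Longrightarrow>
      \<exists>S \<subseteq> K. card S = CARD('d) \<and> v \<notin> S \<and> {v} \<times> S \<subseteq> parcs G"
    and clique: "\<And>u v. u \<in> K \<Longrightarrow> v \<in> K \<Longrightarrow> u \<noteq> v \<Longrightarrow> (u, v) \<in> parcs G"
  shows "generically_rigid TYPE('d) G"
  unfolding generically_rigid_def
proof (intro allI impI)
  fix f :: "'v \<Rightarrow> real ^ 'd"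
  assume gen: "generic_map G f"
  have general: "z = 0"
    if S: "S \<subseteq> K" "card S = CARD('d)" and v: "v \<in> pverts G" "v \<notin> S"
      and z:
      "\<And>u. u \<in> S \<Longrightarrow> z \<bullet> (f u - f v) = 0" for S v z
  proof -
    have "finite S"
      using S(1) K(1) by (rule finite_subset)
    then obtain e :: "'d \<Rightarrow> 'v" where e: "inj e" "range e = S"
      using S(2) by (rule ex_inj_enum)
    show ?thesis
    proof (rule generic_map_general_position[OF gen e(1)])
      show "range e \<subseteq> pverts G" "v \<in> pverts G" "v \<notin> range e"
        using S(1) v e(2) K(2) by auto
      show "z \<bullet> (f (e i) - f v) = 0" for i
        using z e(2) by blast
    qed
  qed
  have "K \<noteq> {}"
    using K(3) by auto
  then obtain w where w: "w \<in> K"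
    by blast
  then have w_vert: "w \<in> pverts G"
    using K(2) by blast
  \<comment> \<open>\<open>w\<close> and \<open>B\<close> span a frame: d + 1 vertices in general
    position, pairwise adjacent because they lie in \<open>K\<close>.\<close>
  obtain B where B: "B \<subseteq> K" "card B = CARD('d)" "w \<notin> B"
    using attached[OF w_vert] by blast
  have "finite B"
    using B(1) K(1) by (rule finite_subset)
  then obtain e :: "'d \<Rightarrow> 'v" where e: "inj e" "range e = B"
    using B(2) by (rule ex_inj_enum)
  note general_B = general[OF B(1,2) w_vert B(3)]
  have eK: "e i \<in> K" "e i \<noteq> w" for i
    using e B by auto
  have "affine hull (f ` pverts G) = UNIV"
  proof (rule affine_hull_eq_UNIV_if_orthogonal[of "f w"])
    show "f w \<in> f ` pverts G"
      using w_vert by (rule imageI)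
  next
    fix z
    assume z: "\<And>x. x \<in> f ` pverts G \<Longrightarrow> z \<bullet> (x - f w) = 0"
    show "z = 0"
      by (rule general_B, rule z) (use B(1) K(2) in blast)
  qed
  moreover have "trivial_motion G f a" if mot: "motion G f a" for a
  proof -
    have arc: "(a v - a u) \<bullet> (f v - f u) = 0" if "(u, v) \<in> parcs G" for u v
      using mot that unfolding motion_def by blast
    have arcK: "(a v - a u) \<bullet> (f v - f u) = 0" if "u \<in> K" "v \<in> K" for u v
      using arc clique that by (cases "u = v") auto
    obtain T where T: "linear T" "\<And>i. T (f (e i) - f w) = a (e i) - a w" "\<And>y. T y \<bullet> y = 0"
    proof (rule ex_skew_linear_extension[of "\<lambda>i. f (e i) - f w" "\<lambda>i. a (e i) - a w"])
      fix z
      assume z: "\<And>i. z \<bullet> (f (e i) - f w) = 0"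
      show "z = 0"
        by (rule general_B) (use z e(2) in blast)
    next
      fix i j
      \<comment> \<open>Expanding the condition on the pair \<open>e i\<close>, \<open>e j\<close>
        around \<open>w\<close> and removing the conditions on \<open>w\<close>, \<open>e i\<close>
        and on \<open>w\<close>, \<open>e j\<close> leaves exactly the mixed terms.\<close>
      show "(a (e i) - a w) \<bullet> (f (e j) - f w) + (a (e j) - a w) \<bullet> (f (e i) - f w) = 0"
        using arcK[of "e i" "e j"] arcK[of w "e i"] arcK[of w "e j"] eK w
        by (simp add: algebra_simps)
    qed (rule that)
    define r where "r v = a v - a w - T (f v - f w)" for v
    have T_diff: "T (f v - f u) = T (f v - f w) - T (f u - f w)" for u v
      using linear_diff[OF T(1), of "f v - f w" "f u - f w"] by simp
    have r_orth: "r v \<bullet> (f u - f v) = 0"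
      if "r u = 0" "(a v - a u) \<bullet> (f v - f u) = 0" for u v
    proof -
      have "r v = a v - a u - T (f v - f u)"
        using that(1) unfolding r_def T_diff[of v u] by (simp add: algebra_simps)
      then have "r v \<bullet> (f v - f u) = 0"
        using that(2) T(3) by (simp add: inner_diff_left)
      then show ?thesis
        by (simp add: inner_diff_right)
    qed
    have r_w: "r w = 0"
      using linear_0[OF T(1)] by (simp add: r_def)
    have r_B: "r u = 0" if "u \<in> B" for u
      using that e T(2) unfolding r_def by auto
    \<comment> \<open>Subtracting the condition at \<open>w\<close> from that at \<open>u\<close>
      cancels \<open>f v\<close>, so the general position of the frame applies to every
      \<open>v\<close> in \<open>K\<close>, inside the frame or not.\<close>
    have r_K: "r v = 0" if "v \<in> K" for v
    proof (rule general_B)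
      fix u
      assume u: "u \<in> B"
      have "r v \<bullet> (f u - f v) = 0"
        using u B(1) that by (intro r_orth r_B arcK) auto
      moreover have "r v \<bullet> (f w - f v) = 0"
        using w that by (intro r_orth r_w arcK)
      ultimately show "r v \<bullet> (f u - f w) = 0"
        by (simp add: inner_diff_right)
    qed
    have r_zero: "r v = 0" if v: "v \<in> pverts G" for v
    proof -
      obtain S where S: "S \<subseteq> K" "card S = CARD('d)" "v \<notin> S" "{v} \<times> S \<subseteq> parcs G"
        using attached v by blast
      show ?thesis
      proof (rule general[OF S(1,2) v S(3)])
        fix u
        assume u: "u \<in> S"
        then have "(a u - a v) \<bullet> (f u - f v) = 0"
          by (intro arc) (use S(4) in blast)
        then have "(a v - a u) \<bullet> (f v - f u) = 0"
          by (simp add: algebra_simps)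
        then show "r v \<bullet> (f u - f v) = 0"
          using u S(1) by (intro r_orth r_K) auto
      qed
    qed
    have "(a v - a u) \<bullet> (f v - f u) = 0" if "u \<in> pverts G" "v \<in> pverts G" for u v
    proof -
      have "a v - a u = T (f v - f u)"
        using r_zero[OF that(1)] r_zero[OF that(2)] unfolding r_def T_diff[of v u]
        by (simp add: algebra_simps)
      then show ?thesis
        using T(3) by simp
    qed
    then show ?thesis
      unfolding trivial_motion_def using mot by blast
  qed
  ultimately show "infinitesimally_rigid G f"
    unfolding infinitesimally_rigid_def embedding_def by blast
qed

section \<open>Coinciding neighbours\<close>

text \<open>The coincidence leaves fewer than d edge directions at \<open>s\<close>, so some nonzero
  \<open>z\<close> is orthogonal to all of them, and moving \<open>s\<close> alone along
  \<open>z\<close> is a motion.\<close>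

lemma not_infinitesimally_rigid_if_neighbours_coincide:
  fixes f :: "'v \<Rightarrow> real ^ 'd"
  assumes s: "s \<in> pverts G" and S: "finite S" "card S = CARD('d)"
    and arcs: "\<And>u v. (u, v) \<in> parcs G \<Longrightarrow> (u = s \<longrightarrow> v \<in> S) \<and> (v = s \<longrightarrow> u \<in> S)"
    and ij: "i \<in> S" "j \<in> S" "i \<noteq> j" "f i = f j"
  shows "\<not> infinitesimally_rigid G f"
proof
  assume rigid: "infinitesimally_rigid G f"
  let ?D = "(\<lambda>u. f u - f s) ` S"
  have "\<not> inj_on (\<lambda>u. f u - f s) S"
    using ij by (auto simp: inj_on_def)
  then have "card ?D < CARD('d)"
    using S card_image_le[of S] eq_card_imp_inj_on[of S] by (metis le_neq_implies_less)
  then have "dim ?D < DIM(real ^ 'd)"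
    using dim_le_card'[of ?D] S by simp
  then obtain z where "z \<noteq> 0" "span ?D \<subseteq> {x. z \<bullet> x = 0}"
    using lowdim_subset_hyperplane by blast
  then have z: "z \<bullet> (f u - f s) = 0" if "u \<in> S" for u
    using that span_base[of "f u - f s" ?D] by blast
  define a where "a v = (if v = s then z else 0)" for v
  have "motion G f a"
    unfolding motion_def
  proof clarify
    fix u v
    assume "(u, v) \<in> parcs G"
    then show "(a v - a u) \<bullet> (f v - f u) = 0"
      using arcs[of u v] z[of u] z[of v] by (auto simp: a_def inner_diff_right)
  qed
  then have triv: "(a v - a s) \<bullet> (f v - f s) = 0" if "v \<in> pverts G" for v
    using rigid s that unfolding infinitesimally_rigid_def trivial_motion_def by blast
  \<comment> \<open>Triviality makes \<open>z\<close> orthogonal to every \<open>f v - f s\<close>,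
    which spanning excludes for nonzero \<open>z\<close>.\<close>
  have "z = 0"
  proof (rule orthogonal_affine_hull_UNIV)
    show "affine hull (f ` pverts G) = UNIV"
      using rigid unfolding infinitesimally_rigid_def embedding_def by blast
  next
    fix x
    assume "x \<in> f ` pverts G"
    then obtain v where v: "v \<in> pverts G" "x = f v"
      by blast
    show "z \<bullet> (x - f s) = 0"
      using triv[OF v(1)] v(2) by (cases "v = s") (auto simp: a_def)
  qed
  with \<open>z \<noteq> 0\<close> show False
    by blast
qed

section \<open>Complete graphs with a vertex attached to every d-subset\<close>

text \<open>\<open>set_encode\<close> is injective on finite sets, so distinct subsets get distinct
  labels; the shift by \<open>n\<close> keeps these apart from the clique
  \<open>{..<n}\<close>.\<close>

definition apex :: "nat \<Rightarrow> nat set \<Rightarrow> nat" where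
  "apex n S = n + set_encode S"

definition subsets_of_card :: "nat \<Rightarrow> nat \<Rightarrow> nat set set" where
  "subsets_of_card n d = {S. S \<subseteq> {..<n} \<and> card S = d}"

definition apex_graph :: "nat \<Rightarrow> nat \<Rightarrow> nat pair_pre_digraph" where
  "apex_graph n d =
     \<lparr>pverts = {..<n} \<union> apex n ` subsets_of_card n d,
      parcs = {(u, v). u < n \<and> v < n \<and> u \<noteq> v}
        \<union> (\<Union>S \<in> subsets_of_card n d. {apex n S} \<times> S \<union> S \<times> {apex n S})\<rparr>"

lemma finite_subsets_of_card: "finite (subsets_of_card n d)"
  by (rule finite_subset[of _ "Pow {..<n}"]) (auto simp: subsets_of_card_def)

lemma subsets_of_cardD:
  assumes "S \<in> subsets_of_card n d"
  shows "S \<subseteq> {..<n}" "card S = d" "finite S"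
  using assms finite_subset unfolding subsets_of_card_def by auto

lemma apex_eq_iff:
  "S \<in> subsets_of_card n d \<Longrightarrow> S' \<in> subsets_of_card n d \<Longrightarrow> apex n S = apex n S' \<longleftrightarrow> S = S'"
  by (simp add: apex_def set_encode_eq subsets_of_cardD(3))

lemma apex_not_less [simp]: "\<not> apex n S < n"
  by (simp add: apex_def)

lemma pair_graph_apex_graph: "pair_graph (apex_graph n d)"
proof -
  let ?G = "apex_graph n d"
  have arcs: "parcs ?G \<subseteq> pverts ?G \<times> pverts ?G"
    using subsets_of_cardD(1) by (fastforce simp: apex_graph_def)
  have fin: "finite (pverts ?G)"
    by (simp add: apex_graph_def finite_subsets_of_card)
  have "sym (parcs ?G)"
    by (auto simp: apex_graph_def sym_def)
  then have "symmetric (with_proj ?G)"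
    by (simp add: symmetric_def arcs_ends_conv with_proj_def)
  moreover have "fst e \<noteq> snd e" if "e \<in> parcs ?G" for e
    using that subsets_of_cardD(1) by (fastforce simp: apex_graph_def)
  ultimately show ?thesis
    using arcs fin finite_subset[OF arcs] by unfold_locales auto
qed

lemma generically_rigid_apex_graph:
  assumes "CARD('d::finite) < n"
  shows "generically_rigid TYPE('d) (apex_graph n CARD('d))"
proof (rule generically_rigid_attached_clique[of "{..<n}"])
  fix v
  assume v: "v \<in> pverts (apex_graph n CARD('d))"
  show "\<exists>S \<subseteq> {..<n}. card S = CARD('d) \<and> v \<notin> S \<and> {v} \<times> S \<subseteq> parcs (apex_graph n CARD('d))"
  proof (cases "v < n")
    case True
    \<comment> \<open>A clique vertex takes its d neighbours among the other \<open>n - 1\<close>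
      clique vertices, hence the strict bound on \<open>n\<close>.\<close>
    then have "CARD('d) \<le> card ({..<n} - {v})"
      using assms by simp
    then obtain S where "S \<subseteq> {..<n} - {v}" "card S = CARD('d)"
      by (meson obtain_subset_with_card_n)
    then show ?thesis
      using True by (intro exI[of _ S]) (auto simp: apex_graph_def)
  next
    case False
    then obtain S where S: "S \<in> subsets_of_card n CARD('d)" "v = apex n S"
      using v by (auto simp: apex_graph_def)
    then show ?thesis
      using subsets_of_cardD[OF S(1)] False
      by (intro exI[of _ S]) (auto simp: apex_graph_def)
  qed
qed (use assms in \<open>auto simp: apex_graph_def\<close>)

lemma not_infinitesimally_rigid_apex_graph:
  fixes f :: "nat \<Rightarrow> real ^ 'd"
  assumes d: "2 \<le> CARD('d)" "CARD('d) \<le> n" and coll: "\<not> inj_on f {..<n}"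
  shows "\<not> infinitesimally_rigid (apex_graph n CARD('d)) f"
proof -
  obtain i j where ij: "i < n" "j < n" "i \<noteq> j" "f i = f j"
    using coll by (auto simp: inj_on_def)
  \<comment> \<open>Dimension at least 2 makes room for both colliding vertices in one
    d-subset.\<close>
  obtain S where S: "{i, j} \<subseteq> S" "S \<subseteq> {..<n}" "card S = CARD('d)"
    using exists_subset_between[of "{i, j}" "CARD('d)" "{..<n}"] d ij by auto
  then have S': "S \<in> subsets_of_card n CARD('d)"
    by (simp add: subsets_of_card_def)
  show ?thesis
  proof (rule not_infinitesimally_rigid_if_neighbours_coincide[where s = "apex n S" and S = S and i = i and j = j])
    fix u v
    assume "(u, v) \<in> parcs (apex_graph n CARD('d))"
    then show "(u = apex n S \<longrightarrow> v \<in> S) \<and> (v = apex n S \<longrightarrow> u \<in> S)"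
      using S' subsets_of_cardD(1) by (fastforce simp: apex_graph_def apex_eq_iff)
  qed (use S S' ij subsets_of_cardD(3)[OF S'] in \<open>auto simp: apex_graph_def\<close>)
qed

theorem theorem1p4:
  fixes c :: nat
  assumes "CARD('d::finite) \<ge> 2"
  shows "\<not> rigid_with_locations TYPE('d) c (generically_rigid_graphs TYPE('d))"
proof
  assume "rigid_with_locations TYPE('d) c (generically_rigid_graphs TYPE('d))"
  then obtain A :: "(real ^ 'd) set" where A: "finite A" "card A = c"
    and rigid: "\<And>G. G \<in> generically_rigid_graphs TYPE('d) \<Longrightarrow>
      \<exists>f. f ` pverts G \<subseteq> A \<and> infinitesimally_rigid G f"
    unfolding rigid_with_locations_def by blast
  \<comment> \<open>Exceeds \<open>c\<close>, for the pigeonhole argument, and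
    \<open>CARD('d)\<close>, for generic rigidity.\<close>
  define n where "n = c + CARD('d) + 1"
  have "apex_graph n CARD('d) \<in> generically_rigid_graphs TYPE('d)"
    unfolding generically_rigid_graphs_def
    using pair_graph_apex_graph generically_rigid_apex_graph[where 'd = 'd, of n] by (simp add: n_def)
  then obtain f where f: "f ` pverts (apex_graph n CARD('d)) \<subseteq> A"
    "infinitesimally_rigid (apex_graph n CARD('d)) f"
    using rigid by blast
  have "f ` {..<n} \<subseteq> A"
    using f(1) by (auto simp: apex_graph_def)
  then have "card (f ` {..<n}) \<le> c"
    using A card_mono by blast
  then have "\<not> inj_on f {..<n}"
    by (intro pigeonhole) (simp add: n_def)
  then show False
    using not_infinitesimally_rigid_apex_graph[of n f] assms f(2) by (simp add: n_def)
qed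

end
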